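(* For every integer $r\geq 3$ there exists a constant $C=C(r)>0$ such that, for every positive integer $n$, $$|\mathrm{Forb}_L(n, C^r_{4})|\leq 2^{Cn^{3/2}}.$$
   Context: An $r$-graph ($r$-uniform hypergraph) consists of a vertex set and a set of edges, each edge being an $r$-element subset of the vertex set. An $r$-graph $H$ is linear if $|e\cap e'|\leq 1$ for all distinct $e,e'\in E(H)$. The linear cycle $C_4^r$ is an $r$-graph with four edges $e_1,e_2,e_3,e_4$ such that $|e_1\cap e_2|=|e_2\cap e_3|=|e_3\cap e_4|=|e_4\cap e_1|=1$ and $e_1\cap e_3=e_2\cap e_4=\emptyset$. $\mathrm{Forb}_L(n, C_4^r)$ denotes the set of linear $r$-graphs with vertex set $[n]=\{1,\ldots,n\}$ that contain no $C_4^r$ as a subgraph. *)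

theory Defs
  imports Complex_Main "HOL-Library.Ramsey"
begin

type_synonym 'a hypergraph = "'a set \<times> 'a set set"

abbreviation verts :: "'a hypergraph \<Rightarrow> 'a set" where
  "verts H \<equiv> fst H"

abbreviation edges :: "'a hypergraph \<Rightarrow> 'a set set" where
  "edges H \<equiv> snd H"

definition uniform_hypergraph :: "nat \<Rightarrow> 'a hypergraph \<Rightarrow> bool" where
  "uniform_hypergraph r H \<longleftrightarrow> edges H \<subseteq> nsets (verts H) r"

definition linear_hypergraph :: "'a hypergraph \<Rightarrow> bool" where
  "linear_hypergraph H \<longleftrightarrow>
     (\<forall>e\<in>edges H. \<forall>e'\<in>edges H. e \<noteq> e' \<longrightarrow> card (e \<inter> e') \<le> 1)"

definition subhypergraph :: "'a hypergraph \<Rightarrow> 'a hypergraph \<Rightarrow> bool" where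
  "subhypergraph G H \<longleftrightarrow> verts G \<subseteq> verts H \<and> edges G \<subseteq> edges H"

text \<open>The cycle has no isolated vertices: its vertex set is the union of its edges. For \<open>r \<ge> 2\<close>
  the conditions below determine it up to isomorphism.\<close>

definition linear_C4 :: "nat \<Rightarrow> 'a hypergraph \<Rightarrow> bool" where
  "linear_C4 r G \<longleftrightarrow> uniform_hypergraph r G \<and> verts G = \<Union>(edges G) \<and>
     (\<exists>e1 e2 e3 e4. distinct [e1, e2, e3, e4] \<and> edges G = {e1, e2, e3, e4} \<and>
        card (e1 \<inter> e2) = 1 \<and> card (e2 \<inter> e3) = 1 \<and>
        card (e3 \<inter> e4) = 1 \<and> card (e4 \<inter> e1) = 1 \<and>
        e1 \<inter> e3 = {} \<and> e2 \<inter> e4 = {})"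

definition Forb_L_C4 :: "nat \<Rightarrow> nat \<Rightarrow> nat hypergraph set" where
  "Forb_L_C4 n r =
     {H. verts H = {1..n} \<and> uniform_hypergraph r H \<and> linear_hypergraph H \<and>
         \<not> (\<exists>G. linear_C4 r G \<and> subhypergraph G H)}"

text \<open>Finiteness ensures that \<open>card\<close> really counts the family.\<close>

lemma finite_Forb_L_C4: "finite (Forb_L_C4 n r)"
proof (rule finite_subset)
  show "Forb_L_C4 n r \<subseteq> {{1..n}} \<times> Pow (Pow {1..n})"
    by (fastforce simp: Forb_L_C4_def uniform_hypergraph_def nsets_def)
qed simp

end

theory Submission
  imports Defs
begin

text \<open>Let \<open>H\<close> be a linear \<open>r\<close>-graph on \<open>n\<close> vertices without a linear 4-cycle, and let its shadow be
  the graph of all pairs contained in an edge. The shadow may contain many 4-cycles, but these are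
  spread out. The four edges of \<open>H\<close> that carry a 4-cycle of the shadow must coincide or meet in
  places where those of a linear 4-cycle do not, and linearity leaves few possibilities for this. So
  two distinct vertices have at most \<open>t = O(r\<^sup>2)\<close> common neighbours in the shadow
  (\<open>card_common_nbrs\<close>), and, using this once more, every edge of the shadow lies in only \<open>O(1)\<close>
  of its 4-cycles (\<open>card_closing\<close>), with constants depending on \<open>r\<close>.

  The second fact makes it possible to colour the edges of the shadow greedily with \<open>O(1)\<close> colours
  such that no 4-cycle is monochromatic (\<open>C4_free_decomposition\<close>). The shadow is then a union of
  \<open>O(1)\<close> graphs without 4-cycles, and by the theorem of Kleitman and Winston there are only
  \<open>exp (O(n powr (3/2)))\<close> of those (\<open>card_C4_free_graphs_le\<close>). This bounds the number of shadows. The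
  first fact bounds the number of hypergraphs with a given shadow: an edge of a graph with
  codegrees at most \<open>t\<close> lies in at most \<open>2 ^ (t + 2)\<close> cliques, the shadow has \<open>O(n powr (3/2))\<close> edges,
  and \<open>H\<close> is a set of \<open>r\<close>-cliques of its shadow.

  The theorem of Kleitman and Winston is proved by deleting a vertex of minimum degree. If the
  remaining graph has \<open>k\<close> vertices and minimum degree \<open>d\<close>, then the neighbourhood of the deleted
  vertex has at most \<open>d + 1\<close> elements and contains no two vertices that have a common neighbour in
  the remaining graph. The pairs with a common neighbour form a graph
  that is dense on every large vertex set (\<open>two_path_dense\<close>). Such a graph has few independent
  sets (\<open>indep_poly_fingerprint\<close>): reading the vertices in order of decreasing degree, every vertex
  put into the independent set excludes many others, so a short fingerprint confines the set to a
  small container. This leaves \<open>exp (O(sqrt k))\<close> neighbourhoods (\<open>card_extensions_le\<close>).\<close>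

section \<open>Counting independent sets in locally dense graphs\<close>

definition indep_sets :: "('a \<Rightarrow> 'a \<Rightarrow> bool) \<Rightarrow> 'a set \<Rightarrow> 'a set set" where
  "indep_sets F S = {A. A \<subseteq> S \<and> (\<forall>x\<in>A. \<forall>y\<in>A. \<not> F x y)}"

definition indep_poly :: "('a \<Rightarrow> 'a \<Rightarrow> bool) \<Rightarrow> real \<Rightarrow> 'a set \<Rightarrow> real" where
  "indep_poly F l S = (\<Sum>A\<in>indep_sets F S. l ^ card A)"

lemma finite_indep_sets: "finite S \<Longrightarrow> finite (indep_sets F S)"
  unfolding indep_sets_def by (rule finite_subset[of _ "Pow S"]) auto

lemma indep_poly_mono:
  assumes "finite S" "T \<subseteq> S" "0 \<le> l"
  shows "indep_poly F l T \<le> indep_poly F l S"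
  unfolding indep_poly_def
proof (rule sum_mono2)
  show "finite (indep_sets F S)" using assms finite_indep_sets by blast
  show "indep_sets F T \<subseteq> indep_sets F S" using assms by (auto simp: indep_sets_def)
qed (use assms in auto)

text \<open>An independent set either avoids \<open>x\<close>, or is \<open>x\<close> together with an independent set of
  non-neighbours of \<open>x\<close>. This recursion drives all estimates below.\<close>

lemma indep_poly_delete:
  assumes "finite S" "x \<in> S" "0 \<le> l"
  shows "indep_poly F l S \<le> indep_poly F l (S - {x}) + l * indep_poly F l {y \<in> S. y \<noteq> x \<and> \<not> F x y}"
proof -
  let ?T = "{y \<in> S. y \<noteq> x \<and> \<not> F x y}"
  have fin: "finite (indep_sets F (S - {x}))" "finite (indep_sets F ?T)"
    using assms finite_indep_sets[of "S - {x}" F] finite_indep_sets[of ?T F] by auto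
  have sub: "indep_sets F S \<subseteq> indep_sets F (S - {x}) \<union> insert x ` indep_sets F ?T"
  proof
    fix A assume A: "A \<in> indep_sets F S"
    show "A \<in> indep_sets F (S - {x}) \<union> insert x ` indep_sets F ?T"
    proof (cases "x \<in> A")
      case True
      then have "A - {x} \<in> indep_sets F ?T" using A by (auto simp: indep_sets_def)
      moreover have "A = insert x (A - {x})" using True by auto
      ultimately show ?thesis by blast
    qed (use A in \<open>auto simp: indep_sets_def\<close>)
  qed
  have "indep_poly F l S \<le> (\<Sum>A\<in>indep_sets F (S - {x}) \<union> insert x ` indep_sets F ?T. l ^ card A)"
    unfolding indep_poly_def by (rule sum_mono2) (use sub fin assms in auto)
  also have "\<dots> \<le> (\<Sum>A\<in>indep_sets F (S - {x}). l ^ card A) + (\<Sum>A\<in>insert x ` indep_sets F ?T. l ^ card A)"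
    by (subst sum.union_inter[symmetric]) (use fin assms in \<open>auto intro!: sum_nonneg\<close>)
  also have "(\<Sum>A\<in>insert x ` indep_sets F ?T. l ^ card A) = (\<Sum>A\<in>indep_sets F ?T. l ^ card (insert x A))"
    by (rule sum.reindex[unfolded o_def]) (auto simp: inj_on_def indep_sets_def)
  also have "\<dots> = (\<Sum>A\<in>indep_sets F ?T. l * l ^ card A)"
  proof (rule sum.cong)
    fix A assume "A \<in> indep_sets F ?T"
    then have "x \<notin> A" "finite A" using assms by (auto simp: indep_sets_def intro: finite_subset[of _ S])
    then show "l ^ card (insert x A) = l * l ^ card A" by simp
  qed simp
  finally show ?thesis by (simp add: indep_poly_def sum_distrib_left)
qed

lemma indep_poly_le_exp:
  assumes "finite S" "0 \<le> l"
  shows "indep_poly F l S \<le> exp (l * card S)"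
  using assms(1)
proof (induction S)
  case empty
  have "indep_sets F {} = {{}}" by (auto simp: indep_sets_def)
  then show ?case by (simp add: indep_poly_def)
next
  case (insert x S)
  have "indep_poly F l (insert x S) \<le> indep_poly F l (insert x S - {x})
      + l * indep_poly F l {y \<in> insert x S. y \<noteq> x \<and> \<not> F x y}"
    by (rule indep_poly_delete) (use insert assms in auto)
  also have "\<dots> \<le> indep_poly F l S + l * indep_poly F l S"
    by (intro add_mono mult_left_mono indep_poly_mono) (use insert assms in auto)
  also have "\<dots> = (1 + l) * indep_poly F l S" by (simp add: algebra_simps)
  also have "\<dots> \<le> exp l * exp (l * card S)"
    using insert.IH assms by (intro mult_mono exp_ge_add_one_self)
      (auto simp: indep_poly_def intro!: sum_nonneg)
  also have "\<dots> = exp (l * card (insert x S))"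
    using insert by (simp add: exp_add[symmetric] algebra_simps)
  finally show ?case .
qed

text \<open>The Kleitman--Winston algorithm in recursive form. As long as more than \<open>L\<close> vertices are
  present, some vertex \<open>x\<close> is adjacent to a proportion \<open>b\<close> of them. Deciding that \<open>x\<close> is in the
  independent set leaves at most a proportion \<open>1 - b\<close> of the vertices, which can happen only \<open>j\<close>
  times before at most \<open>L\<close> of them are left; deciding that \<open>x\<close> is not in it removes just \<open>x\<close>. Between two
  decisions of the first kind there are at most \<open>card V + 1\<close> possibilities, whence the power of
  \<open>card V + 1\<close>; the factor \<open>exp (l * L)\<close> pays for arbitrary subsets of the last \<open>L\<close> vertices. The
  weight \<open>l\<close> makes that payment small when only small independent sets are of interest.\<close>

lemma indep_poly_fingerprint:
  fixes b L l :: real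
  assumes V: "finite V" and l: "0 \<le> l" "l \<le> 1"
    and dense: "\<And>S. S \<subseteq> V \<Longrightarrow> L < card S \<Longrightarrow> \<exists>x\<in>S. b * card S \<le> card {y \<in> S. y \<noteq> x \<and> F x y}"
  shows "S \<subseteq> V \<Longrightarrow> (1 - b) ^ j * card S \<le> L \<Longrightarrow>
     indep_poly F l S \<le> (card V + 1) ^ j * exp (l * L)"
proof (induction j arbitrary: S)
  case 0
  have "finite S" using 0 V finite_subset by blast
  then have "indep_poly F l S \<le> exp (l * card S)" using indep_poly_le_exp l by blast
  also have "\<dots> \<le> exp (l * L)" using 0 l by (auto intro: mult_left_mono)
  finally show ?case by simp
next
  case (Suc j)
  let ?M = "(card V + 1) ^ j * exp (l * L)"
  have M: "exp (l * L) \<le> ?M" by simp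
  have "T \<subseteq> S \<Longrightarrow> indep_poly F l T \<le> (card T + 1) * ?M" for T
  proof (induction "card T" arbitrary: T rule: less_induct)
    case less
    have finT: "finite T" using less.prems Suc.prems V by (meson finite_subset)
    have TV: "T \<subseteq> V" using less.prems Suc.prems by blast
    show ?case
    proof (cases "card T \<le> L")
      case True
      have "indep_poly F l T \<le> exp (l * card T)" using indep_poly_le_exp l finT by blast
      also have "\<dots> \<le> exp (l * L)" using True l by (auto intro: mult_left_mono)
      also have "\<dots> \<le> (card T + 1) * ?M"
        using mult_mono[of 1 "real (card T + 1)" "exp (l * L)" ?M] M by auto
      finally show ?thesis .
    next
      case False
      then obtain x where x: "x \<in> T" "b * card T \<le> card {y \<in> T. y \<noteq> x \<and> F x y}"
        using dense[OF TV] by force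
      let ?N = "{y \<in> T. y \<noteq> x \<and> F x y}" and ?R = "{y \<in> T. y \<noteq> x \<and> \<not> F x y}"
      have cT: "card T > 0" using x finT card_gt_0_iff by blast
      have "card ?N \<le> card T" using finT by (intro card_mono) auto
      with x have "b * card T \<le> 1 * card T" by linarith
      then have b: "b \<le> 1" using cT by (simp del: mult_1)
      have "card ?R + card ?N = card (?R \<union> ?N)"
        using finT by (subst card_Un_disjoint) auto
      also have "\<dots> \<le> card T" using finT by (intro card_mono) auto
      finally have "real (card ?R) \<le> (1 - b) * card T" using x by (simp add: algebra_simps)
      also have "\<dots> \<le> (1 - b) * card S"
        using less.prems Suc.prems V b by (intro mult_left_mono) (auto intro!: card_mono intro: finite_subset)
      finally have "(1 - b) ^ j * card ?R \<le> (1 - b) ^ j * ((1 - b) * card S)"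
        using b by (intro mult_left_mono) auto
      then have "(1 - b) ^ j * card ?R \<le> L" using Suc.prems by (simp add: mult_ac)
      then have R: "indep_poly F l ?R \<le> ?M" using TV by (intro Suc.IH) auto
      have cTx: "card (T - {x}) = card T - 1" using x by simp
      have "indep_poly F l (T - {x}) \<le> (card (T - {x}) + 1) * ?M"
        using less.prems cT x by (intro less.hyps) auto
      also have "\<dots> = card T * ?M" using cT cTx by simp
      finally have D: "indep_poly F l (T - {x}) \<le> card T * ?M" .
      have "indep_poly F l T \<le> indep_poly F l (T - {x}) + l * indep_poly F l ?R"
        by (rule indep_poly_delete) (use finT x l in auto)
      also have "\<dots> \<le> card T * ?M + 1 * ?M"
        using D R l by (intro add_mono mult_mono) (auto simp: indep_poly_def intro!: sum_nonneg)
      finally show ?thesis by (simp add: algebra_simps)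
    qed
  qed
  from this[of S] have "indep_poly F l S \<le> (card S + 1) * ?M" by simp
  also have "\<dots> \<le> (card V + 1) * ?M"
    using Suc.prems V by (intro mult_right_mono) (auto intro: card_mono)
  finally show ?case by (simp only: power_Suc of_nat_mult mult_ac)
qed

text \<open>Passing from the weighted to the plain count: every set of size at most \<open>m\<close> has weight
  at least \<open>l ^ m\<close>.\<close>

lemma card_small_indep_sets_le:
  fixes l :: real
  assumes "finite V" "0 < l" "l \<le> 1"
  shows "card {A \<in> indep_sets F V. card A \<le> m} \<le> (1 / l) ^ m * indep_poly F l V"
proof -
  let ?A = "{A \<in> indep_sets F V. card A \<le> m}"
  have "real (card ?A) * l ^ m = (\<Sum>A\<in>?A. l ^ m)" by simp
  also have "\<dots> \<le> (\<Sum>A\<in>?A. l ^ card A)"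
    using assms by (intro sum_mono power_decreasing) auto
  also have "\<dots> \<le> indep_poly F l V" unfolding indep_poly_def
    by (rule sum_mono2) (use assms finite_indep_sets in auto)
  finally show ?thesis using assms by (simp add: field_simps)
qed

section \<open>Counting graphs without 4-cycles\<close>

definition nbrs :: "'a set set \<Rightarrow> 'a \<Rightarrow> 'a set" where
  "nbrs E v = {u. {u, v} \<in> E}"

lemma nbrs_sym: "u \<in> nbrs E v \<longleftrightarrow> v \<in> nbrs E u"
  unfolding nbrs_def by (simp add: insert_commute[of u v])

lemma nbrs_subset: "E \<subseteq> [V]\<^bsup>2\<^esup> \<Longrightarrow> nbrs E v \<subseteq> V - {v}"
  by (auto simp: nbrs_def nsets_def)

text \<open>A graph is given by its set of edges. Two distinct vertices with two common neighbours
  are opposite vertices of a 4-cycle.\<close>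

definition C4_free_graphs :: "'a set \<Rightarrow> 'a set set set" where
  "C4_free_graphs V = {E. E \<subseteq> [V]\<^bsup>2\<^esup> \<and>
     (\<forall>u v x y. u \<noteq> v \<longrightarrow> {x, y} \<subseteq> nbrs E u \<inter> nbrs E v \<longrightarrow> x = y)}"

lemma C4_freeD:
  assumes "E \<in> C4_free_graphs V" "u \<noteq> v" "x \<in> nbrs E u" "x \<in> nbrs E v" "y \<in> nbrs E u" "y \<in> nbrs E v"
  shows "x = y"
  using assms unfolding C4_free_graphs_def by blast

lemma nbrs_mono: "E' \<subseteq> E \<Longrightarrow> nbrs E' v \<subseteq> nbrs E v"
  by (auto simp: nbrs_def)

lemma C4_free_mono: "E \<in> C4_free_graphs V \<Longrightarrow> E' \<subseteq> E \<Longrightarrow> E' \<subseteq> [V']\<^bsup>2\<^esup> \<Longrightarrow> E' \<in> C4_free_graphs V'"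
  using nbrs_mono[of E' E] unfolding C4_free_graphs_def by blast

lemma finite_C4_free_graphs: "finite V \<Longrightarrow> finite (C4_free_graphs V)"
  by (rule finite_subset[of _ "Pow ([V]\<^bsup>2\<^esup>)"])
    (auto simp: C4_free_graphs_def intro: finite_imp_finite_nsets)

text \<open>The auxiliary graph: adding a new vertex with neighbourhood \<open>A\<close> to a \<open>C\<^sub>4\<close>-free graph
  creates no 4-cycle exactly when \<open>A\<close> is independent for this relation.\<close>

definition two_path :: "'a set set \<Rightarrow> 'a \<Rightarrow> 'a \<Rightarrow> bool" where
  "two_path E x y \<longleftrightarrow> x \<noteq> y \<and> nbrs E x \<inter> nbrs E y \<noteq> {}"

text \<open>The paths of length two from \<open>x\<close> have distinct end points, because two of them with the
  same end would form a 4-cycle. So the degree of \<open>x\<close> can be counted through the middle vertices.\<close>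

lemma card_two_path:
  assumes E: "E \<in> C4_free_graphs V" and V: "finite V" and S: "S \<subseteq> V" "x \<in> S"
  shows "real (card {y \<in> S. y \<noteq> x \<and> two_path E x y}) = (\<Sum>u\<in>nbrs E x. real (card (nbrs E u \<inter> S)) - 1)"
proof -
  have sub: "E \<subseteq> [V]\<^bsup>2\<^esup>" using E by (simp add: C4_free_graphs_def)
  have fin: "finite (nbrs E u)" for u using nbrs_subset[OF sub, of u] V by (meson finite_Diff finite_subset)
  have "y \<in> {y \<in> S. y \<noteq> x \<and> two_path E x y} \<longleftrightarrow> y \<in> (\<Union>u\<in>nbrs E x. nbrs E u \<inter> S - {x})" for y
  proof
    assume "y \<in> {y \<in> S. y \<noteq> x \<and> two_path E x y}"
    then obtain u where "u \<in> nbrs E x" "u \<in> nbrs E y" "y \<in> S" "y \<noteq> x"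
      by (auto simp: two_path_def)
    then show "y \<in> (\<Union>u\<in>nbrs E x. nbrs E u \<inter> S - {x})" using nbrs_sym[of u E y] by auto
  next
    assume "y \<in> (\<Union>u\<in>nbrs E x. nbrs E u \<inter> S - {x})"
    then obtain u where "u \<in> nbrs E x" "y \<in> nbrs E u" "y \<in> S" "y \<noteq> x" by auto
    then show "y \<in> {y \<in> S. y \<noteq> x \<and> two_path E x y}"
      using nbrs_sym[of u E y] by (auto simp: two_path_def)
  qed
  then have eq: "{y \<in> S. y \<noteq> x \<and> two_path E x y} = (\<Union>u\<in>nbrs E x. nbrs E u \<inter> S - {x})"
    by blast
  have disj: "card (\<Union>u\<in>nbrs E x. nbrs E u \<inter> S - {x}) = (\<Sum>u\<in>nbrs E x. card (nbrs E u \<inter> S - {x}))"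
  proof (rule card_UN_disjoint)
    show "\<forall>i\<in>nbrs E x. \<forall>j\<in>nbrs E x. i \<noteq> j \<longrightarrow> (nbrs E i \<inter> S - {x}) \<inter> (nbrs E j \<inter> S - {x}) = {}"
    proof (intro ballI impI equals0I)
      fix i j z assume "i \<in> nbrs E x" "j \<in> nbrs E x" "i \<noteq> j"
        and "z \<in> (nbrs E i \<inter> S - {x}) \<inter> (nbrs E j \<inter> S - {x})"
      moreover from this have "x \<in> nbrs E i" "x \<in> nbrs E j"
        using nbrs_sym[of i E x] nbrs_sym[of j E x] by simp_all
      ultimately show False using C4_freeD[OF E, of i j x z] by auto
    qed
  qed (simp_all add: fin)
  show ?thesis unfolding eq disj of_nat_sum
  proof (rule sum.cong)
    fix u assume "u \<in> nbrs E x"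
    then have x: "x \<in> nbrs E u \<inter> S" using S nbrs_sym[of u E x] by simp
    then have "card (nbrs E u \<inter> S) > 0" using fin[of u] by (auto simp: card_gt_0_iff)
    then show "real (card (nbrs E u \<inter> S - {x})) = real (card (nbrs E u \<inter> S)) - 1"
      using x by (simp add: of_nat_diff)
  qed simp
qed

text \<open>The vertices of \<open>S\<close> send at least \<open>d * card S\<close> edges to the \<open>card V\<close> vertices of \<open>V\<close>, so
  that a typical vertex has \<open>m = d * card S / card V > 2\<close> neighbours in \<open>S\<close>, and by convexity
  at least \<open>card V * m * (m - 1)\<close> ordered pairs in \<open>S\<close> have a common neighbour.
  Some \<open>x\<close> attains the average of this number over \<open>S\<close>.\<close>

lemma two_path_dense:
  assumes E: "E \<in> C4_free_graphs V" and V: "finite V" and S: "S \<subseteq> V"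
    and deg: "\<And>v. v \<in> V \<Longrightarrow> d \<le> card (nbrs E v)"
    and big: "2 * card V < d * card S"
  shows "\<exists>x\<in>S. (real d)\<^sup>2 / (2 * card V) * card S \<le> card {y \<in> S. y \<noteq> x \<and> two_path E x y}"
proof (rule ccontr)
  let ?N = "\<lambda>x. {y \<in> S. y \<noteq> x \<and> two_path E x y}"
  assume "\<not> ?thesis"
  then have small: "card (?N x) < (real d)\<^sup>2 / (2 * card V) * card S" if "x \<in> S" for x
    using that by force
  have sub: "E \<subseteq> [V]\<^bsup>2\<^esup>" using E by (simp add: C4_free_graphs_def)
  have finS: "finite S" using S V finite_subset by blast
  define k where "k = real (card V)"
  define s where "s u = real (card (nbrs E u \<inter> S))" for u
  define m where "m = d * card S / k"
  have S0: "S \<noteq> {}" using big by auto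
  then have k: "k > 0" using S V unfolding k_def by (metis card_gt_0_iff of_nat_0_less_iff subset_empty)
  have m: "m \<ge> 2" "k * m = d * card S" using big k by (auto simp: m_def k_def field_simps simp flip: of_nat_mult)
  have nb: "nbrs E x = {u \<in> V. u \<in> nbrs E x}" for x using nbrs_subset[OF sub, of x] by blast
  have nb': "{x \<in> S. u \<in> nbrs E x} = nbrs E u \<inter> S" for u by (simp add: nbrs_sym[of u E] Int_def conj_commute)
  have swap: "(\<Sum>x\<in>S. \<Sum>u\<in>nbrs E x. f u) = (\<Sum>u\<in>V. s u * f u)" for f :: "'a \<Rightarrow> real"
  proof -
    have "(\<Sum>x\<in>S. \<Sum>u\<in>nbrs E x. f u) = (\<Sum>x\<in>S. \<Sum>u\<in>{u \<in> V. u \<in> nbrs E x}. f u)"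
      using nb by simp
    also have "\<dots> = (\<Sum>u\<in>V. \<Sum>x\<in>{x \<in> S. u \<in> nbrs E x}. f u)"
      by (rule sum.swap_restrict) (use finS V in auto)
    finally show ?thesis by (simp add: nb' s_def)
  qed
  have "(\<Sum>x\<in>S. real d) \<le> (\<Sum>x\<in>S. \<Sum>u\<in>nbrs E x. 1)"
    by (intro sum_mono) (use deg S in auto)
  then have D: "k * m \<le> (\<Sum>u\<in>V. s u)" using swap[of "\<lambda>_. 1"] m by (simp add: mult.commute)
  \<comment> \<open>Convexity enters as the tangent \<open>s\<^sup>2 \<ge> 2 * m * s - m\<^sup>2\<close> of the square at \<open>m\<close>.\<close>
  have "k * m * m / 2 \<le> k * m * (m - 1)"
    using mult_right_mono[OF m(1), of "k * m"] m k by (simp add: algebra_simps)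
  also have "\<dots> = (2 * m - 1) * (k * m) - k * m\<^sup>2" by (simp add: algebra_simps power2_eq_square)
  also have "\<dots> \<le> (2 * m - 1) * (\<Sum>u\<in>V. s u) - k * m\<^sup>2"
    using D m by (intro diff_right_mono mult_left_mono) auto
  also have "\<dots> = (\<Sum>u\<in>V. (2 * m - 1) * s u - m\<^sup>2)"
    by (simp add: sum_subtractf sum_distrib_left k_def)
  also have "\<dots> \<le> (\<Sum>u\<in>V. s u * (s u - 1))"
  proof (rule sum_mono)
    fix u
    have "0 \<le> (s u - m)\<^sup>2" by simp
    then show "(2 * m - 1) * s u - m\<^sup>2 \<le> s u * (s u - 1)"
      by (simp add: power2_eq_square algebra_simps)
  qed
  also have "\<dots> = (\<Sum>x\<in>S. \<Sum>u\<in>nbrs E x. s u - 1)" by (rule swap[symmetric])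
  also have "\<dots> = (\<Sum>x\<in>S. real (card (?N x)))"
    by (rule sum.cong) (use card_two_path[OF E V S] in \<open>auto simp: s_def\<close>)
  also have "\<dots> < (\<Sum>x\<in>S. (real d)\<^sup>2 / (2 * card V) * card S)"
    by (rule sum_strict_mono) (use small finS S0 in auto)
  also have "\<dots> = (k * m) * m / 2" unfolding m(2) using k by (simp add: m_def k_def field_simps power2_eq_square)
  finally show False by simp
qed

text \<open>These sets include every neighbourhood of a new vertex that has minimum degree in a
  \<open>C\<^sub>4\<close>-free extension of \<open>E\<close>; the \<open>1\<close> allows for the new edge at an old vertex.\<close>

definition extensions :: "'a set \<Rightarrow> 'a set set \<Rightarrow> 'a set set" where
  "extensions V E = {A \<in> indep_sets (two_path E) V. \<forall>v\<in>V. card A \<le> card (nbrs E v) + 1}"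

lemma ln_power8_le: "x \<ge> 1 \<Longrightarrow> ln (x ^ 8) \<le> 8 * (x::real)"
  using ln_bound[of x] by (simp add: ln_realpow)

text \<open>Let \<open>d\<close> be the minimum degree, so that the sets to be counted have at most \<open>d + 1\<close> elements,
  and write \<open>k = card V\<close>. If \<open>d \<le> k powr (3/8)\<close>, there are few sets of that size altogether. Otherwise
  the auxiliary graph has relative density \<open>b = d\<^sup>2 / (2 * k)\<close> on sets with more than
  \<open>L = 2 * k / d\<close> elements, so a fingerprint of \<open>q \<approx> ln k / b\<close> vertices determines a set of \<open>L\<close>
  vertices containing the rest. The threshold 3/8 leaves room for logarithms on both sides: both
  \<open>d * ln k\<close> in the first case and \<open>q * ln k\<close> in the second are \<open>O(sqrt k)\<close>. Everything is measured
  in \<open>x = root 8 k\<close>, where \<open>ln k \<le> 8 * x\<close> and \<open>sqrt k = x ^ 4\<close>.\<close>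

lemma card_extensions_le:
  assumes E: "E \<in> C4_free_graphs V" and V: "finite V"
  shows "card (extensions V E) \<le> exp (280 * sqrt (card V))"
proof (cases "V = {}")
  case True
  then have "extensions V E = {{}}" by (auto simp: extensions_def indep_sets_def two_path_def)
  then show ?thesis by simp
next
  case False
  define k where "k = card V"
  define x where "x = root 8 (real k)"
  define d where "d = Min ((\<lambda>v. card (nbrs E v)) ` V)"
  have k: "k \<ge> 1" using False V by (simp add: k_def Suc_leI card_gt_0_iff)
  have x1: "x \<ge> 1" using k by (simp add: x_def)
  have kx: "real k = x ^ 8" using k by (simp add: x_def)
  have sq: "sqrt (real k) = x ^ 4" using x1 unfolding kx
    by (intro real_sqrt_unique) (auto simp flip: power_mult)
  have deg: "d \<le> card (nbrs E v)" if "v \<in> V" for v using that V by (simp add: d_def)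
  have ext: "extensions V E \<subseteq> {A \<in> indep_sets (two_path E) V. card A \<le> d + 1}"
  proof -
    have "d \<in> (\<lambda>v. card (nbrs E v)) ` V" unfolding d_def using V False by (intro Min_in) auto
    then show ?thesis by (auto simp: extensions_def)
  qed
  let ?I = "{A \<in> indep_sets (two_path E) V. card A \<le> d + 1}"
  have finI: "finite ?I" using finite_indep_sets[OF V] by simp
  have pw: "x ^ i \<le> x ^ j" if "i \<le> j" for i j using x1 that by (rule power_increasing[rotated])
  have "real (card ?I) \<le> exp (280 * x ^ 4)"
  proof (cases "real d \<le> x ^ 3")
    case True
    \<comment> \<open>With weight \<open>1 / k\<close> the weighted count is bounded by \<open>exp 1\<close> for trivial reasons.\<close>
    have "card ?I \<le> (1 / (1 / real k)) ^ (d + 1) * indep_poly (two_path E) (1 / k) V"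
      by (rule card_small_indep_sets_le) (use V k in auto)
    also have "\<dots> \<le> (1 / (1 / real k)) ^ (d + 1) * exp (1 / real k * card V)"
      by (intro mult_left_mono indep_poly_le_exp) (use V in auto)
    also have "\<dots> = real k ^ (d + 1) * exp 1" using k by (simp add: k_def)
    also have "\<dots> = exp (real (d + 1) * ln (real k) + 1)"
      using k by (simp add: exp_add exp_of_nat_mult[of "d+1", simplified] power_add exp_of_nat_mult algebra_simps)
    also have "real (d + 1) * ln (real k) + 1 \<le> (x ^ 3 + 1) * (8 * x) + 1"
      using True k ln_power8_le[OF x1] unfolding kx[symmetric]
      by (intro add_mono mult_mono) auto
    also have "\<dots> \<le> 280 * x ^ 4" using pw[of 1 4] pw[of 0 4] by (simp add: algebra_simps eval_nat_numeral)
    finally show ?thesis by simp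
  next
    case False
    have d: "real d > 0" using False x1 by (smt (verit) zero_le_power)
    have "\<exists>v. v \<in> V" using \<open>V \<noteq> {}\<close> by blast
    then have dk: "d \<le> k" using deg nbrs_subset[of E V] E V unfolding C4_free_graphs_def k_def
      by (smt (verit) Diff_subset card_mono mem_Collect_eq order_trans)
    define b where "b = (real d)\<^sup>2 / (2 * k)"
    define L where "L = 2 * real k / d"
    \<comment> \<open>This weight balances the two costs: \<open>l * L\<close> and \<open>(d + 1) * ln (1 / l)\<close> are both
      \<open>O(sqrt k)\<close>, uniformly in \<open>d\<close>.\<close>
    define l where "l = real d / (d + 2 * x ^ 4)"
    define q where "q = nat \<lceil>ln k / b\<rceil>"
    have b: "b > 0" using d k by (simp add: b_def)
    have L: "L \<ge> 1" using d dk by (simp add: L_def)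
    have x4: "x ^ 4 \<ge> 1" using x1 by simp
    have l: "0 < l" "l \<le> 1" using d x4 by (auto simp: l_def field_simps)
    have dense: "\<exists>x\<in>S. b * card S \<le> card {y \<in> S. y \<noteq> x \<and> two_path E x y}"
      if "S \<subseteq> V" "L < card S" for S
    proof -
      have "real (2 * card V) < real (d * card S)" using that d by (simp add: L_def k_def field_simps)
      then have "2 * card V < d * card S" by (simp only: of_nat_less_iff)
      then show ?thesis using two_path_dense[OF E V that(1) deg] unfolding b_def k_def by simp
    qed
    \<comment> \<open>If already \<open>k \<le> L\<close>, the fingerprint is empty; density, and with it \<open>b \<le> 1\<close>, is known for larger sets only.\<close>
    have poly: "indep_poly (two_path E) l V \<le> (k + 1) ^ q * exp (l * L)"
    proof (cases "real k \<le> L")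
      case True
      have "indep_poly (two_path E) l V \<le> exp (l * k)" 
        using indep_poly_le_exp[OF V, of l] l by (simp add: k_def)
      also have "\<dots> \<le> 1 * exp (l * L)" using True l by simp
      also have "\<dots> \<le> (k + 1) ^ q * exp (l * L)" by (intro mult_right_mono) auto
      finally show ?thesis .
    next
      case False
      obtain z where z: "b * k \<le> card {y \<in> V. y \<noteq> z \<and> two_path E z y}"
        using dense[of V] False by (auto simp: k_def)
      have "card {y \<in> V. y \<noteq> z \<and> two_path E z y} \<le> k"
        unfolding k_def by (rule card_mono) (use V in auto)
      then have "b * k \<le> 1 * k" using z by linarith
      then have b1: "b \<le> 1" using k by (simp del: mult_1)
      have "(1 - b) ^ q \<le> exp (- b) ^ q"
        using b1 exp_ge_add_one_self[of "- b"] by (intro power_mono) auto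
      also have "\<dots> = exp (- (b * q))" by (simp add: exp_of_nat_mult[symmetric] mult.commute)
      also have "\<dots> \<le> exp (- ln k)"
      proof -
        have "ln k / b \<le> q" unfolding q_def by linarith
        then show ?thesis using b by (simp add: field_simps)
      qed
      also have "\<dots> = 1 / k" using k by (simp add: exp_minus field_simps)
      finally have "(1 - b) ^ q * card V \<le> 1" using k by (simp add: k_def field_simps)
      then have "(1 - b) ^ q * card V \<le> L" using L by linarith
      then show ?thesis
        using indep_poly_fingerprint[OF V _ _ dense, where S=V and l=l and j=q] l by (simp add: k_def)
    qed
    have "card ?I \<le> (1 / l) ^ (d + 1) * indep_poly (two_path E) l V"
      by (rule card_small_indep_sets_le[OF V l])
    also have "\<dots> \<le> (1 / l) ^ (d + 1) * ((k + 1) ^ q * exp (l * L))"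
      using poly l by (intro mult_left_mono) auto
    \<comment> \<open>The constant of the lemma is the sum of these exponents, rounded up.\<close>
    also have "\<dots> \<le> exp (4 * x ^ 4) * (exp (256 * x ^ 4 + 16 * x ^ 4) * exp (x ^ 4))"
    proof (intro mult_mono)
      have "1 / l = 1 + 2 * x ^ 4 / d" using d by (simp add: l_def field_simps)
      then have "(1 / l) ^ (d + 1) \<le> exp (2 * x ^ 4 / d) ^ (d + 1)"
        using l by (intro power_mono) auto
      also have "\<dots> = exp (real (d + 1) * (2 * x ^ 4 / d))" by (simp only: exp_of_nat_mult)
      also have "real (d + 1) * (2 * x ^ 4 / d) \<le> 4 * x ^ 4"
        using d x4 mult_right_mono[of 1 "real d" "x ^ 4"] by (simp add: field_simps)
      finally show "(1 / l) ^ (d + 1) \<le> exp (4 * x ^ 4)" by simp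
      have "l * L = 2 * x ^ 8 / (d + 2 * x ^ 4)" using d by (simp add: l_def L_def kx)
      also have "\<dots> \<le> x ^ 4" using d x4 by (simp add: field_simps flip: power_add)
      finally show "exp (l * L) \<le> exp (x ^ 4)" by simp
      have lnk: "0 \<le> ln k" "ln k \<le> 8 * x" using k ln_power8_le[OF x1] unfolding kx[symmetric] by auto
      have "ln k / b \<le> (8 * x) / ((x ^ 3)\<^sup>2 / (2 * k))"
        unfolding b_def using lnk False k x1
        by (intro frac_le divide_right_mono power_mono) auto
      also have "\<dots> = 16 * x ^ 3" using x1 by (simp add: kx field_simps eval_nat_numeral)
      finally have "real q \<le> 16 * x ^ 3 + 1" using lnk b unfolding q_def
        by (smt (verit) divide_nonneg_pos of_int_ceiling_le_add_one of_nat_nat zero_le_ceiling)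
      moreover have "ln (real (k + 1)) \<le> 16 * x"
      proof -
        have "real (k + 1) \<le> (2 * x) ^ 8" using k kx by (simp add: power_mult_distrib)
        then have "ln (real (k + 1)) \<le> ln ((2 * x) ^ 8)" using x1 by (intro ln_mono) auto
        also have "\<dots> \<le> 8 * (2 * x)" by (rule ln_power8_le) (use x1 in auto)
        finally show ?thesis by simp
      qed
      ultimately have "real q * ln (real (k + 1)) \<le> (16 * x ^ 3 + 1) * (16 * x)"
        using x1 by (intro mult_mono) auto
      also have "\<dots> \<le> 256 * x ^ 4 + 16 * x ^ 4"
        using pw[of 1 4] by (simp add: algebra_simps eval_nat_numeral)
      finally have "exp (real q * ln (real (k + 1))) \<le> exp (256 * x ^ 4 + 16 * x ^ 4)" by simp
      then show "real ((k + 1) ^ q) \<le> exp (256 * x ^ 4 + 16 * x ^ 4)" by (simp add: exp_of_nat_mult)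
    qed (use l in auto)
    also have "\<dots> \<le> exp (280 * x ^ 4)" using x4 by (simp flip: exp_add)
    finally show ?thesis .
  qed
  moreover have "card (extensions V E) \<le> card ?I" using ext finI by (rule card_mono[rotated])
  ultimately show ?thesis using sq by (simp add: k_def)
qed

text \<open>A \<open>C\<^sub>4\<close>-free graph is determined by a vertex of minimum degree, its neighbourhood, and the
  graph that remains when it is deleted.\<close>

lemma C4_free_graphs_remove_min_degree:
  assumes V: "finite V" "V \<noteq> {}"
  shows "C4_free_graphs V \<subseteq> (\<Union>v\<in>V. (\<lambda>(E, A). E \<union> (\<lambda>a. {a, v}) ` A) `
           (SIGMA E : C4_free_graphs (V - {v}). extensions (V - {v}) E))"
proof
  fix E assume E: "E \<in> C4_free_graphs V"
  have sub: "E \<subseteq> [V]\<^bsup>2\<^esup>" using E by (simp add: C4_free_graphs_def)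
  define v where "v = arg_min_on (\<lambda>v. card (nbrs E v)) V"
  have v: "v \<in> V" unfolding v_def by (rule arg_min_if_finite(1)[OF V])
  have min: "card (nbrs E v) \<le> card (nbrs E w)" if "w \<in> V" for w
    using arg_min_if_finite(2)[OF V, of "\<lambda>v. card (nbrs E v)"] that unfolding v_def by force
  define E' where "E' = {e \<in> E. v \<notin> e}"
  have E'sub: "E' \<subseteq> [V - {v}]\<^bsup>2\<^esup>" using sub by (auto simp: E'_def nsets_def)
  have E': "E' \<in> C4_free_graphs (V - {v})"
    by (rule C4_free_mono[OF E _ E'sub]) (auto simp: E'_def)
  have "nbrs E v \<in> extensions (V - {v}) E'"
  proof -
    have "\<not> two_path E' x y" if x: "x \<in> nbrs E v" and y: "y \<in> nbrs E v" for x y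
    proof
      assume "two_path E' x y"
      then obtain u where u: "x \<noteq> y" "u \<in> nbrs E' x" "u \<in> nbrs E' y" by (auto simp: two_path_def)
      then have "u \<noteq> v" "u \<in> nbrs E x" "u \<in> nbrs E y" by (auto simp: nbrs_def E'_def)
      then show False using C4_freeD[OF E, of u v x y] x y u nbrs_sym[of u E x] nbrs_sym[of u E y] by simp
    qed
    moreover have "card (nbrs E v) \<le> card (nbrs E' w) + 1" if "w \<in> V - {v}" for w
    proof -
      have fin: "finite (nbrs E' w)"
        by (rule finite_subset[OF nbrs_subset[OF E'sub]]) (use V in auto)
      have "nbrs E w \<subseteq> insert v (nbrs E' w)" using that by (auto simp: nbrs_def E'_def)
      then have "card (nbrs E w) \<le> card (insert v (nbrs E' w))" using fin by (intro card_mono) auto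
      also have "\<dots> \<le> card (nbrs E' w) + 1" using fin by (simp add: card_insert_if)
      finally show ?thesis using min[of w] that by simp
    qed
    ultimately show ?thesis using nbrs_subset[OF sub, of v] by (auto simp: extensions_def indep_sets_def)
  qed
  moreover have "E = E' \<union> (\<lambda>a. {a, v}) ` nbrs E v"
  proof (rule set_eqI)
    fix e
    show "e \<in> E \<longleftrightarrow> e \<in> E' \<union> (\<lambda>a. {a, v}) ` nbrs E v"
    proof (cases "v \<in> e \<and> e \<in> E")
      case True
      then obtain a where "e = {a, v}" using sub by (auto simp: nsets_def card_2_iff)
      then show ?thesis using True by (auto simp: nbrs_def)
    qed (auto simp: E'_def nbrs_def)
  qed
  ultimately show "E \<in> (\<Union>v\<in>V. (\<lambda>(E, A). E \<union> (\<lambda>a. {a, v}) ` A) `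
           (SIGMA E : C4_free_graphs (V - {v}). extensions (V - {v}) E))"
    using v E' by (intro UN_I[of v] image_eqI[where x = "(E', nbrs E v)"]) auto
qed

lemma card_C4_free_graphs_power:
  assumes "finite V" "card V \<le> n"
  shows "card (C4_free_graphs V) \<le> (n * exp (280 * sqrt n)) ^ card V"
  using assms
proof (induction "card V" arbitrary: V)
  case 0
  then have "C4_free_graphs V \<subseteq> {{}}" by (auto simp: C4_free_graphs_def nsets_def)
  then have "card (C4_free_graphs V) \<le> card {{} :: 'a set set}" by (intro card_mono) auto
  then show ?case using 0 by simp
next
  case (Suc k)
  let ?M = "n * exp (280 * sqrt n)"
  let ?S = "\<lambda>v. SIGMA E : C4_free_graphs (V - {v}). extensions (V - {v}) E"
  have V: "V \<noteq> {}" using Suc.hyps by auto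
  have fin: "finite (C4_free_graphs (V - {v}))" "finite (extensions (V - {v}) E)" for v E
    using Suc.prems by (simp_all add: extensions_def finite_C4_free_graphs finite_indep_sets)
  have one: "real (card (?S v)) \<le> ?M ^ k * exp (280 * sqrt n)" if "v \<in> V" for v
  proof -
    have cv: "card (V - {v}) = k" using that Suc by simp
    have "real (card (?S v)) = (\<Sum>E\<in>C4_free_graphs (V - {v}). real (card (extensions (V - {v}) E)))"
      using fin by simp
    also have "\<dots> \<le> (\<Sum>E\<in>C4_free_graphs (V - {v}). exp (280 * sqrt n))"
    proof (rule sum_mono)
      fix E assume "E \<in> C4_free_graphs (V - {v})"
      then have "card (extensions (V - {v}) E) \<le> exp (280 * sqrt (card (V - {v})))"
        using Suc.prems by (intro card_extensions_le) auto
      also have "\<dots> \<le> exp (280 * sqrt n)" using cv Suc by simp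
      finally show "card (extensions (V - {v}) E) \<le> exp (280 * sqrt n)" .
    qed
    also have "\<dots> = card (C4_free_graphs (V - {v})) * exp (280 * sqrt n)" by simp
    also have "\<dots> \<le> ?M ^ k * exp (280 * sqrt n)"
      using Suc.hyps(1)[of "V - {v}"] cv Suc.prems Suc.hyps by (intro mult_right_mono) auto
    finally show ?thesis .
  qed
  have "card (C4_free_graphs V) \<le> card (\<Union>v\<in>V. (\<lambda>(E, A). E \<union> (\<lambda>a. {a, v}) ` A) ` ?S v)"
    by (rule card_mono[OF _ C4_free_graphs_remove_min_degree]) (use Suc.prems V fin in auto)
  also have "\<dots> \<le> (\<Sum>v\<in>V. card ((\<lambda>(E, A). E \<union> (\<lambda>a. {a, v}) ` A) ` ?S v))"
    by (rule card_UN_le) (use Suc.prems in auto)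
  also have "\<dots> \<le> (\<Sum>v\<in>V. card (?S v))"
    by (intro sum_mono card_image_le) (use fin in auto)
  finally have "real (card (C4_free_graphs V)) \<le> (\<Sum>v\<in>V. real (card (?S v)))"
    by (simp flip: of_nat_sum)
  also have "\<dots> \<le> (\<Sum>v\<in>V. ?M ^ k * exp (280 * sqrt n))" by (rule sum_mono) (use one in auto)
  also have "\<dots> = card V * (?M ^ k * exp (280 * sqrt n))" by simp
  also have "\<dots> \<le> n * (?M ^ k * exp (280 * sqrt n))"
    using Suc.prems by (intro mult_right_mono) auto
  also have "\<dots> = ?M ^ card V" by (simp add: Suc.hyps(2)[symmetric])
  finally show ?case .
qed

text \<open>The theorem of Kleitman and Winston. Each of the \<open>n\<close> vertices costs a factor
  \<open>n * exp (280 * sqrt n)\<close>, in which \<open>n \<le> exp (2 * sqrt n)\<close> is absorbed.\<close>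

theorem card_C4_free_graphs_le:
  assumes "finite V" "card V = n"
  shows "card (C4_free_graphs V) \<le> exp (282 * n powr (3/2))"
proof (cases "n = 0")
  case True
  then show ?thesis using card_C4_free_graphs_power[OF assms(1), of n] assms by simp
next
  case False
  define s where "s = sqrt (real n)"
  have s: "s > 0" "real n = s * s" using False by (auto simp: s_def)
  have "ln (real n) = 2 * ln s" using s by (simp add: ln_mult)
  also have "ln s \<le> s" using s ln_bound by blast
  finally have "exp (ln (real n)) \<le> exp (2 * s)" by simp
  then have "real n \<le> exp (2 * s)" using False by simp
  then have "n * exp (280 * s) \<le> exp (2 * s) * exp (280 * s)" by (intro mult_right_mono) auto
  also have "\<dots> = exp (2 * s + 280 * s)" by (simp only: exp_add)
  finally have M: "n * exp (280 * s) \<le> exp (282 * s)" by simp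
  have "card (C4_free_graphs V) \<le> (n * exp (280 * s)) ^ n"
    using card_C4_free_graphs_power[OF assms(1), of n] assms by (simp add: s_def)
  also have "\<dots> \<le> exp (282 * s) ^ n" using M by (intro power_mono) auto
  also have "\<dots> = exp (282 * (n * s))" 
    using exp_of_nat_mult[of n "282 * s"] by (simp add: mult_ac)
  also have "n * s = n powr (3/2)"
  proof -
    have "n powr (3/2) = n powr (1 + 1/2)" by simp
    also have "\<dots> = n * s" unfolding s_def using False by (subst powr_add) (simp add: powr_half_sqrt)
    finally show ?thesis by simp
  qed
  finally show ?thesis .
qed

text \<open>The extremal bound follows from the counting theorem, since all \<open>2 ^ card E\<close> subgraphs of
  \<open>E\<close> are \<open>C\<^sub>4\<close>-free as well.\<close>

lemma card_C4_free_edges_le: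
  assumes V: "finite V" "card V = n" and E: "E \<in> C4_free_graphs V"
  shows "card E \<le> 282 / ln 2 * n powr (3/2)"
proof -
  have fin: "finite E" using E V by (auto simp: C4_free_graphs_def intro: finite_subset finite_imp_finite_nsets)
  have "Pow E \<subseteq> C4_free_graphs V"
  proof
    fix E' assume "E' \<in> Pow E"
    then have "E' \<subseteq> E" "E' \<subseteq> [V]\<^bsup>2\<^esup>" using E by (auto simp: C4_free_graphs_def)
    then show "E' \<in> C4_free_graphs V" using C4_free_mono[OF E] by blast
  qed
  then have "card (Pow E) \<le> card (C4_free_graphs V)"
    using V finite_C4_free_graphs card_mono by blast
  then have "real (2 ^ card E) \<le> real (card (C4_free_graphs V))" using fin by (simp add: card_Pow)
  also have "\<dots> \<le> exp (282 * n powr (3/2))" by (rule card_C4_free_graphs_le[OF V])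
  finally have "ln (2 ^ card E) \<le> ln (exp (282 * n powr (3/2)))" by (subst ln_le_cancel_iff) auto
  then have "card E * ln 2 \<le> 282 * n powr (3/2)" by (simp add: ln_realpow)
  then show ?thesis by (simp add: field_simps)
qed

section \<open>Shadows of linear hypergraphs without linear 4-cycles\<close>

definition shadow :: "'a set set \<Rightarrow> 'a set set" where
  "shadow E = (\<Union>e\<in>E. [e]\<^bsup>2\<^esup>)"

lemma in_shadow: "{u, v} \<in> shadow E \<longleftrightarrow> u \<noteq> v \<and> (\<exists>e\<in>E. u \<in> e \<and> v \<in> e)"
  by (auto simp: shadow_def simp del: insert_absorb2)

lemma nbrs_shadow: "u \<in> nbrs (shadow E) v \<longleftrightarrow> u \<noteq> v \<and> (\<exists>e\<in>E. u \<in> e \<and> v \<in> e)"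
  unfolding nbrs_def by (simp add: in_shadow)

text \<open>For \<open>x \<noteq> y\<close> in a linear hypergraph this is the unique edge through \<open>x\<close> and \<open>y\<close>, or empty.
  Having it as a total function allows unions over arbitrary pairs of vertices.\<close>

definition span :: "'a set set \<Rightarrow> 'a \<Rightarrow> 'a \<Rightarrow> 'a set" where
  "span E x y = \<Union>{e \<in> E. x \<in> e \<and> y \<in> e}"

text \<open>The vertices \<open>u\<close> for which the path \<open>v, x, u\<close> can be closed to a 4-cycle \<open>v, x, u, y\<close>.\<close>

definition closing :: "'a set set \<Rightarrow> 'a \<Rightarrow> 'a \<Rightarrow> 'a set" where
  "closing G v x = {u \<in> nbrs G x. u \<noteq> v \<and> (\<exists>y. y \<noteq> x \<and> y \<in> nbrs G u \<and> y \<in> nbrs G v)}"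

lemma card_UN_bound:
  assumes "finite I" "\<And>i. i \<in> I \<Longrightarrow> card (A i) \<le> b" "card I \<le> a"
  shows "card (\<Union>i\<in>I. A i) \<le> a * b"
proof -
  have "card (\<Union>i\<in>I. A i) \<le> (\<Sum>i\<in>I. card (A i))" using assms by (intro card_UN_le)
  also have "\<dots> \<le> card I * b" using assms sum_bounded_above[of I "\<lambda>i. card (A i)" b] by simp
  finally show ?thesis using assms(3) by (meson mult_le_mono1 order_trans)
qed

definition codeg_bound :: "nat \<Rightarrow> nat" where
  "codeg_bound r = 3 * r + 2 * r * r"

definition closing_bound :: "nat \<Rightarrow> nat" where
  "closing_bound r = (r + r * (codeg_bound r * r)) * codeg_bound r"

locale linear_C4_free =
  fixes V :: "'a set" and E :: "'a set set" and r :: nat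
  assumes finV: "finite V"
    and uniform: "E \<subseteq> [V]\<^bsup>r\<^esup>"
    and linear: "\<lbrakk>e \<in> E; e' \<in> E; e \<noteq> e'\<rbrakk> \<Longrightarrow> card (e \<inter> e') \<le> 1"
    and no_C4: "\<not> (\<exists>G. linear_C4 r G \<and> subhypergraph G (V, E))"
begin

abbreviation "N \<equiv> nbrs (shadow E)"

lemma edge: "e \<in> E \<Longrightarrow> e \<subseteq> V \<and> finite e \<and> card e = r"
  using uniform by (auto simp: nsets_def)

lemma edge_unique:
  assumes "e \<in> E" "e' \<in> E" "x \<in> e" "x \<in> e'" "y \<in> e" "y \<in> e'" "x \<noteq> y"
  shows "e = e'"
proof (rule ccontr)
  assume "e \<noteq> e'"
  then have "card (e \<inter> e') \<le> 1" using linear assms by blast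
  moreover have "card {x, y} \<le> card (e \<inter> e')"
    using assms edge[of e] by (intro card_mono) auto
  ultimately show False using assms by simp
qed

lemma shadow_graph: "shadow E \<subseteq> [V]\<^bsup>2\<^esup>"
  using edge by (fastforce simp: shadow_def nsets_def)

lemma fin_N: "finite (N v)"
  by (rule finite_subset[OF nbrs_subset[OF shadow_graph]]) (use finV in auto)

lemma span_edge: "e \<in> E \<Longrightarrow> x \<in> e \<Longrightarrow> y \<in> e \<Longrightarrow> x \<noteq> y \<Longrightarrow> span E x y = e"
  unfolding span_def using edge_unique by blast

lemma card_span:
  assumes "x \<noteq> y"
  shows "finite (span E x y) \<and> card (span E x y) \<le> r"
proof (cases "\<exists>e\<in>E. x \<in> e \<and> y \<in> e")
  case True
  then obtain e where "e \<in> E" "x \<in> e" "y \<in> e" by blast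
  then show ?thesis using span_edge[of e x y] edge[of e] assms by simp
next
  case False
  then have "span E x y = {}" by (auto simp: span_def)
  then show ?thesis by simp
qed

lemma no_linear_4_cycle:
  assumes e: "e1 \<in> E" "e2 \<in> E" "e3 \<in> E" "e4 \<in> E"
    and ne: "e1 \<noteq> e2" "e2 \<noteq> e3" "e3 \<noteq> e4" "e4 \<noteq> e1"
    and meet: "a \<in> e1" "a \<in> e2" "b \<in> e2" "b \<in> e3" "c \<in> e3" "c \<in> e4" "d \<in> e4" "d \<in> e1"
  shows "e1 \<inter> e3 \<noteq> {} \<or> e2 \<inter> e4 \<noteq> {}"
proof (rule ccontr)
  assume disj: "\<not> ?thesis"
  have one: "card (f \<inter> g) = 1" if "f \<in> E" "g \<in> E" "f \<noteq> g" "z \<in> f" "z \<in> g" for f g z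
  proof -
    have "finite (f \<inter> g)" using edge that by blast
    then have "card (f \<inter> g) > 0" using that card_gt_0_iff by blast
    then show ?thesis using linear[of f g] that by linarith
  qed
  let ?G = "(\<Union>{e1, e2, e3, e4}, {e1, e2, e3, e4})"
  have "uniform_hypergraph r ?G"
    using edge e by (auto simp: uniform_hypergraph_def nsets_def)
  moreover have "distinct [e1, e2, e3, e4]" using ne meet disj by auto
  moreover have "card (e1 \<inter> e2) = 1" "card (e2 \<inter> e3) = 1" "card (e3 \<inter> e4) = 1" "card (e4 \<inter> e1) = 1"
    using one e ne meet by blast+
  ultimately have "linear_C4 r ?G" unfolding linear_C4_def
    using disj by (intro conjI) (simp, simp, rule exI[of _ e1], rule exI[of _ e2],
      rule exI[of _ e3], rule exI[of _ e4], simp)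
  moreover have "subhypergraph ?G (V, E)" using e edge by (auto simp: subhypergraph_def)
  ultimately show False using no_C4 by blast
qed

text \<open>Fix one common neighbour \<open>b\<close> outside the edge spanned by \<open>a\<close> and \<open>a'\<close>, joined to them by
  the edges \<open>e\<close> and \<open>f\<close>. Any other common neighbour \<open>b'\<close>, joined by \<open>e'\<close> and \<open>f'\<close>, yields a linear
  4-cycle \<open>e, f, f', e'\<close> unless two of these edges coincide or opposite ones meet. In each
  exceptional case \<open>b'\<close> lies in one of boundedly many edges that are determined by \<open>a\<close>, \<open>a'\<close>, \<open>e\<close> and \<open>f\<close>: an edge
  through \<open>a'\<close> that meets \<open>e\<close> in \<open>z\<close> is spanned by \<open>a'\<close> and \<open>z\<close>.\<close>

lemma card_common_nbrs:
  assumes "a \<noteq> a'"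
  shows "card (N a \<inter> N a') \<le> codeg_bound r"
proof (cases "N a \<inter> N a' \<subseteq> span E a a'")
  case True
  then have "card (N a \<inter> N a') \<le> card (span E a a')" using card_span[OF assms] by (intro card_mono) auto
  also have "\<dots> \<le> r" using card_span[OF assms] by blast
  finally show ?thesis by (simp add: codeg_bound_def)
next
  case False
  then obtain b where b: "b \<in> N a" "b \<in> N a'" "b \<notin> span E a a'" by blast
  then obtain e f where e: "e \<in> E" "b \<in> e" "a \<in> e" and f: "f \<in> E" "b \<in> f" "a' \<in> f"
    and ba: "b \<noteq> a" "b \<noteq> a'" by (auto simp: nbrs_shadow)
  have out: "a' \<notin> e" "a \<notin> f" using b e f by (auto simp: span_def)
  let ?C = "span E a a' \<union> e \<union> f \<union> (\<Union>z\<in>e. span E a' z) \<union> (\<Union>z\<in>f. span E a z)"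
  have "N a \<inter> N a' \<subseteq> ?C"
  proof
    fix b' assume b': "b' \<in> N a \<inter> N a'"
    then obtain e' f' where e': "e' \<in> E" "b' \<in> e'" "a \<in> e'" and f': "f' \<in> E" "b' \<in> f'" "a' \<in> f'"
      by (auto simp: nbrs_shadow)
    show "b' \<in> ?C"
    proof (cases "b' \<in> span E a a' \<or> b' \<in> e \<or> b' \<in> f")
      case False
      then have "e' \<noteq> f'" "e \<noteq> f" "e \<noteq> e'" "f \<noteq> f'" using e f e' f' out by (auto simp: span_def)
      then have "e \<inter> f' \<noteq> {} \<or> f \<inter> e' \<noteq> {}"
        using no_linear_4_cycle[of e f f' e' b a' b' a] e f e' f' by auto
      then show ?thesis using e' f' by (auto simp: span_def)
    qed auto
  qed
  moreover have "finite ?C"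
  proof -
    have "finite (span E a' z)" if "z \<in> e" for z using that out card_span[of a' z] by auto
    moreover have "finite (span E a z)" if "z \<in> f" for z using that out card_span[of a z] by auto
    ultimately show ?thesis using edge e f card_span[OF assms] by auto
  qed
  ultimately have "card (N a \<inter> N a') \<le> card ?C" by (intro card_mono) auto
  also have "\<dots> \<le> card (span E a a') + card e + card f + card (\<Union>z\<in>e. span E a' z) + card (\<Union>z\<in>f. span E a z)"
    by (meson add_mono card_Un_le order_refl order_trans)
  also have "\<dots> \<le> r + r + r + r * r + r * r"
  proof (intro add_mono card_UN_bound)
    show "card (span E a' z) \<le> r" if "z \<in> e" for z using that out card_span[of a' z] by auto
    show "card (span E a z) \<le> r" if "z \<in> f" for z using that out card_span[of a z] by auto
  qed (use edge e f card_span[OF assms] in auto)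
  finally show ?thesis by (simp add: codeg_bound_def)
qed

text \<open>The edges that realise a 4-cycle \<open>v, x, u, y\<close> of the shadow do not form a linear 4-cycle.
  Hence two of them coincide or opposite ones meet; either way one of the two edges at \<open>u\<close> avoids
  \<open>v\<close> and meets both edges at \<open>v\<close>.\<close>

lemma bridging_edge:
  assumes vx: "x \<in> N v" and vy: "y \<in> N v" and u: "u \<in> N x" "u \<in> N y" "u \<noteq> v"
    and e: "e \<in> E" "v \<in> e" "x \<in> e" and e': "e' \<in> E" "v \<in> e'" "y \<in> e'" and ne: "e \<noteq> e'"
  shows "\<exists>k\<in>E. v \<notin> k \<and> k \<inter> e \<noteq> {} \<and> k \<inter> e' \<noteq> {}"
proof -
  obtain g h where g: "g \<in> E" "x \<in> g" "u \<in> g" and h: "h \<in> E" "y \<in> h" "u \<in> h"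
    using u by (auto simp: nbrs_shadow)
  have ineq: "x \<noteq> v" "y \<noteq> v" "u \<noteq> x" "u \<noteq> y" using vx vy u by (auto simp: nbrs_shadow)
  have ge: "g = e" if "v \<in> g" using edge_unique[of g e x v] g e that ineq by auto
  have he: "h = e'" if "v \<in> h" using edge_unique[of h e' y v] h e' that ineq by auto
  consider "v \<in> g" "v \<in> h" | "v \<in> g" "v \<notin> h" | "v \<notin> g" "v \<in> h" | "v \<notin> g" "v \<notin> h" by blast
  then show ?thesis
  proof cases
    case 1
    then have "u \<in> e" "u \<in> e'" using ge he g h by auto
    then show ?thesis using edge_unique[of e e' u v] e e' u ne by auto
  next
    case 2
    then show ?thesis using ge g h e' by blast
  next
    case 3
    then show ?thesis using he g h e by blast
  next
    case 4
    show ?thesis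
    proof (cases "g = h")
      case True
      then show ?thesis using 4 g h e e' by blast
    next
      case False
      then have "e \<inter> h \<noteq> {} \<or> g \<inter> e' \<noteq> {}"
        using no_linear_4_cycle[of e g h e' x u y v] e e' g h ne 4 by auto
      then show ?thesis using 4 g h e e' by blast
    qed
  qed
qed

text \<open>By the previous lemma a closing vertex is adjacent to some \<open>y \<in> e'\<close> for an edge \<open>e'\<close> at
  \<open>v\<close> that is either the edge \<open>e\<close> spanned by \<open>v\<close> and \<open>x\<close> or joined to \<open>e\<close>. A joining edge contains some
  \<open>p \<in> e\<close> and some \<open>p' \<in> e'\<close>, and \<open>p'\<close> is a common neighbour of \<open>p\<close> and \<open>v\<close>. So bounded codegrees
  leave boundedly many \<open>p'\<close>, thus boundedly many \<open>e'\<close> and \<open>y\<close>, and finally boundedly many common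
  neighbours \<open>u\<close> of \<open>x\<close> and \<open>y\<close>.\<close>

lemma card_closing:
  assumes vx: "x \<in> N v"
  shows "card (closing (shadow E) v x) \<le> closing_bound r"
proof -
  obtain e where e: "e \<in> E" "v \<in> e" "x \<in> e" using vx by (auto simp: nbrs_shadow)
  define Y where "Y = {y \<in> N v. y \<noteq> x \<and> (\<exists>u. u \<noteq> v \<and> u \<in> N x \<and> u \<in> N y)}"
  let ?C = "\<Union>p\<in>e - {v}. \<Union>p'\<in>N p \<inter> N v. span E v p'"
  have finsp: "finite (span E v p') \<and> card (span E v p') \<le> r" if "p' \<in> N v" for p'
    using card_span[of v p'] that by (auto simp: nbrs_shadow)
  have Y: "Y \<subseteq> e \<union> ?C"
  proof
    fix y assume "y \<in> Y"
    then obtain u where y: "y \<in> N v" "y \<noteq> x" and u: "u \<noteq> v" "u \<in> N x" "u \<in> N y" by (auto simp: Y_def)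
    then obtain e' where e': "e' \<in> E" "v \<in> e'" "y \<in> e'" by (auto simp: nbrs_shadow)
    show "y \<in> e \<union> ?C"
    proof (cases "e = e'")
      case False
      then obtain k where k: "k \<in> E" "v \<notin> k" "k \<inter> e \<noteq> {}" "k \<inter> e' \<noteq> {}"
        using bridging_edge[OF vx y(1) u(2,3,1) e e'] by blast
      then obtain p p' where p: "p \<in> k" "p \<in> e" "p' \<in> k" "p' \<in> e'" by blast
      then have pv: "p \<noteq> v" "p' \<noteq> v" using k by auto
      have "p \<noteq> p'" using edge_unique[of e e' p v] e e' p pv False by auto
      then have "p' \<in> N p \<inter> N v" using p k e' pv by (auto simp: nbrs_shadow)
      moreover have "y \<in> span E v p'" using e' p by (auto simp: span_def)
      ultimately show ?thesis using p pv by blast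
    qed (use e' in auto)
  qed
  have "card Y \<le> card (e \<union> ?C)"
    by (rule card_mono[OF _ Y]) (use edge e finsp fin_N in auto)
  also have "\<dots> \<le> card e + card ?C" by (rule card_Un_le)
  also have "\<dots> \<le> r + r * (codeg_bound r * r)"
  proof (intro add_mono card_UN_bound)
    show "card (e - {v}) \<le> r" using edge[OF e(1)] by (metis card_Diff1_le)
    show "card (N p \<inter> N v) \<le> codeg_bound r" if "p \<in> e - {v}" for p
      using card_common_nbrs[of p v] that by auto
  qed (use edge e finsp fin_N in auto)
  finally have cY: "card Y \<le> r + r * (codeg_bound r * r)" .
  have finY: "finite Y" unfolding Y_def using fin_N by auto
  have "closing (shadow E) v x \<subseteq> (\<Union>y\<in>Y. N x \<inter> N y)"
  proof
    fix u assume "u \<in> closing (shadow E) v x"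
    then obtain y where "u \<in> N x" "u \<noteq> v" "y \<noteq> x" "y \<in> N u" "y \<in> N v" by (auto simp: closing_def)
    moreover from this have "u \<in> N y" using nbrs_sym[of y "shadow E" u] by simp
    ultimately show "u \<in> (\<Union>y\<in>Y. N x \<inter> N y)" by (auto simp: Y_def)
  qed
  then have "card (closing (shadow E) v x) \<le> card (\<Union>y\<in>Y. N x \<inter> N y)"
    using finY fin_N by (intro card_mono) auto
  also have "\<dots> \<le> (r + r * (codeg_bound r * r)) * codeg_bound r"
  proof (rule card_UN_bound[OF finY _ cY])
    show "card (N x \<inter> N y) \<le> codeg_bound r" if "y \<in> Y" for y
      using card_common_nbrs[of x y] that by (auto simp: Y_def)
  qed
  finally show ?thesis by (simp add: closing_bound_def)
qed

end

section \<open>Splitting a graph into graphs without 4-cycles\<close>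

lemma greedy_colouring:
  assumes "finite X" and sym: "\<And>p q. R p q \<Longrightarrow> R q p" and irr: "\<And>p. \<not> R p p"
    and "\<And>p. p \<in> X \<Longrightarrow> card {q \<in> X. R p q} \<le> K"
  shows "\<exists>c :: 'b \<Rightarrow> nat. (\<forall>p\<in>X. c p \<le> K) \<and> (\<forall>p\<in>X. \<forall>q\<in>X. R p q \<longrightarrow> c p \<noteq> c q)"
  using assms(1,4)
proof (induction X)
  case (insert x X)
  have "card {q \<in> X. R p q} \<le> K" if "p \<in> X" for p
    using insert.prems[of p] insert.hyps that card_mono[of "{q \<in> insert x X. R p q}" "{q \<in> X. R p q}"]
    by fastforce
  then obtain c :: "'b \<Rightarrow> nat" where c: "\<forall>p\<in>X. c p \<le> K" "\<forall>p\<in>X. \<forall>q\<in>X. R p q \<longrightarrow> c p \<noteq> c q"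
    using insert.IH by blast
  have "card (c ` {q \<in> X. R x q}) \<le> card {q \<in> X. R x q}" using insert.hyps by (intro card_image_le) auto
  also have "\<dots> \<le> card {q \<in> insert x X. R x q}" using insert.hyps by (intro card_mono) auto
  also have "\<dots> \<le> K" using insert.prems[of x] by simp
  finally have "card (c ` {q \<in> X. R x q}) < card {..K}" by simp
  then have "\<not> {..K} \<subseteq> c ` {q \<in> X. R x q}"
    using insert.hyps card_mono[of "c ` {q \<in> X. R x q}" "{..K}"] by auto
  then obtain k where k: "k \<le> K" "k \<notin> c ` {q \<in> X. R x q}" by blast
  show ?case
  proof (intro exI[of _ "c(x := k)"] conjI ballI impI)
    fix p q assume "p \<in> insert x X" "q \<in> insert x X" "R p q"
    then show "(c(x := k)) p \<noteq> (c(x := k)) q"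
      using c k insert.hyps irr[of x] sym[of p q] by auto
  qed (use c k in auto)
qed simp

text \<open>Call two edges of \<open>G\<close> conflicting if they are consecutive on a 4-cycle. An edge lies in
  conflict with at most \<open>2 * K\<close> others, \<open>K\<close> at each end, so greedy colouring uses \<open>2 * K + 1\<close>
  colours, and no 4-cycle is monochromatic.\<close>

lemma C4_free_decomposition:
  assumes V: "finite V" and G: "G \<subseteq> [V]\<^bsup>2\<^esup>"
    and few: "\<And>v x. x \<in> nbrs G v \<Longrightarrow> card (closing G v x) \<le> K"
  shows "\<exists>F. (\<forall>i\<le>2 * K. F i \<in> C4_free_graphs V) \<and> G = (\<Union>i\<le>2 * K. F i)"
proof -
  define R where "R p q \<longleftrightarrow> (\<exists>v x u. p = {v, x} \<and> q = {x, u} \<and> x \<in> nbrs G v \<and> u \<in> closing G v x)" for p q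
  have finG: "finite G" using G V finite_imp_finite_nsets finite_subset by blast
  have fincl: "finite (closing G v x)" for v x
    by (rule finite_subset[of _ V]) (use nbrs_subset[OF G, of x] V in \<open>auto simp: closing_def\<close>)
  have sym: "R q p" if "R p q" for p q
  proof -
    obtain v x u where p: "p = {v, x}" "q = {x, u}" "x \<in> nbrs G v" "u \<in> closing G v x"
      using \<open>R p q\<close> by (auto simp: R_def)
    then have "x \<in> nbrs G u" "v \<in> closing G u x"
      using nbrs_sym[of u G x] nbrs_sym[of x G v] by (auto simp: closing_def)
    then show ?thesis unfolding R_def using p by (metis insert_commute)
  qed
  have irr: "\<not> R p p" for p
    using nbrs_subset[OF G] by (force simp: R_def closing_def doubleton_eq_iff)
  have deg: "card {q \<in> G. R p q} \<le> 2 * K" if "p \<in> G" for p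
  proof -
    have "p \<in> [V]\<^bsup>2\<^esup>" using that G by blast
    then obtain a b where p: "p = {a, b}" by (auto simp: nsets_def card_2_iff)
    then have nb: "a \<in> nbrs G b" "b \<in> nbrs G a" using that by (auto simp: nbrs_def insert_commute)
    have "{q \<in> G. R p q} \<subseteq> (\<lambda>u. {b, u}) ` closing G a b \<union> (\<lambda>u. {a, u}) ` closing G b a"
      by (auto simp: R_def p doubleton_eq_iff)
    then have "card {q \<in> G. R p q} \<le> card ((\<lambda>u. {b, u}) ` closing G a b \<union> (\<lambda>u. {a, u}) ` closing G b a)"
      using fincl by (intro card_mono) auto
    also have "\<dots> \<le> card (closing G a b) + card (closing G b a)"
      by (meson add_mono card_Un_le card_image_le fincl order_trans)
    also have "\<dots> \<le> 2 * K" using few[OF nb(1)] few[OF nb(2)] by simp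
    finally show ?thesis .
  qed
  obtain c :: "'a set \<Rightarrow> nat" where c: "\<forall>p\<in>G. c p \<le> 2 * K" "\<forall>p\<in>G. \<forall>q\<in>G. R p q \<longrightarrow> c p \<noteq> c q"
    using greedy_colouring[OF finG sym irr deg] by blast
  let ?F = "\<lambda>i. {p \<in> G. c p = i}"
  have "?F i \<in> C4_free_graphs V" for i
  proof -
    have "x = y" if uv: "u \<noteq> v" and xy: "{x, y} \<subseteq> nbrs (?F i) u \<inter> nbrs (?F i) v" for u v x y
    proof (rule ccontr)
      assume "x \<noteq> y"
      have *: "{x, u} \<in> G" "{x, v} \<in> G" "{y, u} \<in> G" "{y, v} \<in> G" "c {x, u} = i" "c {x, v} = i"
        using xy by (auto simp: nbrs_def)
      then have "u \<in> closing G v x" "x \<in> nbrs G v"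
        using uv \<open>x \<noteq> y\<close> by (auto simp: closing_def nbrs_def insert_commute)
      then have "R {v, x} {x, u}" by (auto simp: R_def)
      then show False using c(2) * by (auto simp: insert_commute)
    qed
    then show ?thesis using G by (auto simp: C4_free_graphs_def)
  qed
  moreover have "G = (\<Union>i\<le>2 * K. ?F i)" using c by auto
  ultimately show ?thesis by (intro exI[of _ ?F]) auto
qed

text \<open>A clique that contains the edge \<open>{a, b}\<close> lies inside \<open>{a, b}\<close> and the common
  neighbourhood of \<open>a\<close> and \<open>b\<close>.\<close>

lemma card_cliques_le:
  assumes V: "finite V" and G: "G \<subseteq> [V]\<^bsup>2\<^esup>" and r: "r \<ge> 2"
    and codeg: "\<And>a b. a \<noteq> b \<Longrightarrow> card (nbrs G a \<inter> nbrs G b) \<le> t"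
  shows "card {e \<in> [V]\<^bsup>r\<^esup>. [e]\<^bsup>2\<^esup> \<subseteq> G} \<le> card G * 2 ^ (t + 2)"
proof -
  define W where "W p = p \<union> {x. \<forall>a\<in>p. x \<in> nbrs G a}" for p
  have finG: "finite G" using G V finite_imp_finite_nsets finite_subset by blast
  have W: "finite (W p) \<and> card (W p) \<le> t + 2" if "p \<in> G" for p
  proof -
    have "p \<in> [V]\<^bsup>2\<^esup>" using that G by blast
    then obtain a b where p: "p = {a, b}" "a \<noteq> b" by (auto simp: nsets_def card_2_iff)
    then have eq: "W p = p \<union> (nbrs G a \<inter> nbrs G b)" by (auto simp: W_def)
    have "finite (nbrs G a)" using nbrs_subset[OF G, of a] V by (meson finite_Diff finite_subset)
    moreover have "card (W p) \<le> card p + card (nbrs G a \<inter> nbrs G b)" unfolding eq by (rule card_Un_le)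
    ultimately show ?thesis using codeg[OF p(2)] p unfolding eq by auto
  qed
  have "{e \<in> [V]\<^bsup>r\<^esup>. [e]\<^bsup>2\<^esup> \<subseteq> G} \<subseteq> (\<Union>p\<in>G. Pow (W p))"
  proof
    fix e assume e: "e \<in> {e \<in> [V]\<^bsup>r\<^esup>. [e]\<^bsup>2\<^esup> \<subseteq> G}"
    then have "2 \<le> card e" using r by (auto simp: nsets_def)
    then obtain p where p: "p \<subseteq> e" "card p = 2" by (metis obtain_subset_with_card_n)
    have edge: "{x, a} \<in> G" if "x \<in> e" "a \<in> e" "x \<noteq> a" for x a
      using e that by (auto dest!: subsetD[where c = "{x, a}"])
    obtain a b where ab: "p = {a, b}" "a \<noteq> b" using p by (auto simp: card_2_iff)
    then have "p \<in> G" using edge[of a b] p by simp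
    moreover have "e \<subseteq> W p" using edge p by (auto simp: W_def nbrs_def)
    ultimately show "e \<in> (\<Union>p\<in>G. Pow (W p))" by blast
  qed
  then have "card {e \<in> [V]\<^bsup>r\<^esup>. [e]\<^bsup>2\<^esup> \<subseteq> G} \<le> card (\<Union>p\<in>G. Pow (W p))"
    using finG W by (intro card_mono) auto
  also have "\<dots> \<le> card G * 2 ^ (t + 2)"
  proof (rule card_UN_bound[OF finG])
    show "card (Pow (W p)) \<le> 2 ^ (t + 2)" if "p \<in> G" for p
      using W[OF that] power_increasing[of "card (W p)" "t + 2" "2 :: nat"] by (simp only: card_Pow)
  qed simp
  finally show ?thesis .
qed

section \<open>Counting hypergraphs by their shadows\<close>

definition C4_free_unions :: "'a set \<Rightarrow> nat \<Rightarrow> 'a set set set" where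
  "C4_free_unions V k = (\<lambda>F. \<Union>i\<le>k. F i) ` ({..k} \<rightarrow>\<^sub>E C4_free_graphs V)"

lemma C4_free_unionsI:
  assumes "\<And>i. i \<le> k \<Longrightarrow> F i \<in> C4_free_graphs V"
  shows "(\<Union>i\<le>k. F i) \<in> C4_free_unions V k"
  unfolding C4_free_unions_def
  by (rule image_eqI[where x = "restrict F {..k}"]) (use assms in auto)

lemma card_C4_free_unions:
  assumes "finite V"
  shows "finite (C4_free_unions V k)"
    and "card (C4_free_unions V k) \<le> card (C4_free_graphs V) ^ Suc k"
proof -
  have fin: "finite ({..k} \<rightarrow>\<^sub>E C4_free_graphs V)"
    using finite_C4_free_graphs[OF assms] by (intro finite_PiE) auto
  then show "finite (C4_free_unions V k)" by (simp add: C4_free_unions_def)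
  have "card (C4_free_unions V k) \<le> card ({..k} \<rightarrow>\<^sub>E C4_free_graphs V)"
    unfolding C4_free_unions_def using fin by (rule card_image_le)
  also have "\<dots> = card (C4_free_graphs V) ^ Suc k" by (simp add: card_PiE)
  finally show "card (C4_free_unions V k) \<le> card (C4_free_graphs V) ^ Suc k" .
qed

lemma card_edges_C4_free_unions:
  assumes V: "finite V" "card V = n" and G: "G \<in> C4_free_unions V k"
  shows "card G \<le> Suc k * (282 / ln 2 * n powr (3/2))"
proof -
  obtain F where F: "G = (\<Union>i\<le>k. F i)" "\<And>i. i \<le> k \<Longrightarrow> F i \<in> C4_free_graphs V"
    using G by (auto simp: C4_free_unions_def PiE_iff)
  have "card G \<le> (\<Sum>i\<le>k. card (F i))" unfolding F(1) by (rule card_UN_le) simp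
  then have "real (card G) \<le> (\<Sum>i\<le>k. real (card (F i)))" by (simp flip: of_nat_sum)
  also have "\<dots> \<le> (\<Sum>i\<le>k. 282 / ln 2 * n powr (3/2))"
    by (intro sum_mono card_C4_free_edges_le[OF V]) (use F in auto)
  finally show ?thesis by simp
qed

lemma (in linear_C4_free) shadow_in_C4_free_unions:
  "shadow E \<in> C4_free_unions V (2 * closing_bound r)"
proof -
  obtain F where "\<forall>i\<le>2 * closing_bound r. F i \<in> C4_free_graphs V"
    and "shadow E = (\<Union>i\<le>2 * closing_bound r. F i)"
    using C4_free_decomposition[OF finV shadow_graph card_closing] by blast
  then show ?thesis using C4_free_unionsI[of "2 * closing_bound r" F V] by simp
qed

text \<open>The shadow \<open>G\<close> of such a hypergraph is a union of \<open>k\<close> graphs without 4-cycles, which accounts for the summand 1 in the exponent. Given \<open>G\<close>, the hypergraph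
  is a set of \<open>r\<close>-cliques of \<open>G\<close>, and there are at most \<open>card G * 2 ^ (t + 2)\<close> of these, which
  accounts for the other summand.\<close>

lemma card_linear_C4_free:
  fixes V :: "'a set"
  assumes V: "finite V" "card V = n" and r: "r \<ge> 2"
  defines "k \<equiv> Suc (2 * closing_bound r)" and "t \<equiv> codeg_bound r"
  shows "card {E. linear_C4_free V E r} \<le> 2 powr (282 / ln 2 * k * (1 + 2 ^ (t + 2)) * n powr (3/2))"
proof -
  define m where "m = 282 / ln 2 * n powr (3/2)"
  define cl where "cl G = {e \<in> [V]\<^bsup>r\<^esup>. [e]\<^bsup>2\<^esup> \<subseteq> G}" for G
  define \<G> where "\<G> = {G \<in> C4_free_unions V (2 * closing_bound r).
     G \<subseteq> [V]\<^bsup>2\<^esup> \<and> (\<forall>a b. a \<noteq> b \<longrightarrow> card (nbrs G a \<inter> nbrs G b) \<le> t)}"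
  have fin: "finite \<G>" using card_C4_free_unions(1)[OF V(1)] by (simp add: \<G>_def)
  have fincl: "finite (cl G)" for G using finite_imp_finite_nsets[OF V(1)] by (simp add: cl_def)
  have m0: "m \<ge> 0" by (simp add: m_def)
  have "{E. linear_C4_free V E r} \<subseteq> (\<Union>G\<in>\<G>. Pow (cl G))"
  proof
    fix E assume "E \<in> {E. linear_C4_free V E r}"
    then interpret linear_C4_free V E r by simp
    have "shadow E \<in> \<G>"
      using shadow_in_C4_free_unions shadow_graph card_common_nbrs by (simp add: \<G>_def t_def)
    moreover have "E \<subseteq> cl (shadow E)" using uniform by (auto simp: cl_def shadow_def)
    ultimately show "E \<in> (\<Union>G\<in>\<G>. Pow (cl G))" by blast
  qed
  then have "card {E. linear_C4_free V E r} \<le> card (\<Union>G\<in>\<G>. Pow (cl G))"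
    using fin fincl by (intro card_mono) auto
  also have "\<dots> \<le> (\<Sum>G\<in>\<G>. card (Pow (cl G)))" by (rule card_UN_le[OF fin])
  finally have "real (card {E. linear_C4_free V E r}) \<le> (\<Sum>G\<in>\<G>. real (card (Pow (cl G))))"
    by (simp flip: of_nat_sum)
  also have "\<dots> \<le> (\<Sum>G\<in>\<G>. 2 powr (k * m * 2 ^ (t + 2)))"
  proof (rule sum_mono)
    fix G assume "G \<in> \<G>"
    then have G: "G \<in> C4_free_unions V (2 * closing_bound r)" "G \<subseteq> [V]\<^bsup>2\<^esup>"
      "\<And>a b. a \<noteq> b \<Longrightarrow> card (nbrs G a \<inter> nbrs G b) \<le> t" by (auto simp: \<G>_def)
    have "real (card (cl G)) \<le> real (card G * 2 ^ (t + 2))"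
      unfolding cl_def of_nat_le_iff by (rule card_cliques_le[OF V(1) G(2) r G(3)])
    also have "\<dots> = real (card G) * 2 ^ (t + 2)" by simp
    also have "\<dots> \<le> k * m * 2 ^ (t + 2)"
      using card_edges_C4_free_unions[OF V G(1)] by (intro mult_right_mono) (auto simp: k_def m_def)
    finally have "2 powr real (card (cl G)) \<le> 2 powr (k * m * 2 ^ (t + 2))" by simp
    then show "real (card (Pow (cl G))) \<le> 2 powr (k * m * 2 ^ (t + 2))"
      using fincl by (simp add: card_Pow powr_realpow)
  qed
  also have "\<dots> = card \<G> * 2 powr (k * m * 2 ^ (t + 2))" by simp
  also have "\<dots> \<le> 2 powr (k * m) * 2 powr (k * m * 2 ^ (t + 2))"
  proof (rule mult_right_mono)
    have "card \<G> \<le> card (C4_free_unions V (2 * closing_bound r))"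
      by (rule card_mono[OF card_C4_free_unions(1)[OF V(1)]]) (auto simp: \<G>_def)
    also have "\<dots> \<le> card (C4_free_graphs V) ^ k"
      unfolding k_def by (rule card_C4_free_unions(2)[OF V(1)])
    finally have "real (card \<G>) \<le> real (card (C4_free_graphs V)) ^ k"
      by (simp flip: of_nat_power)
    also have "\<dots> \<le> exp (282 * n powr (3/2)) ^ k"
      using card_C4_free_graphs_le[OF V] by (intro power_mono) auto
    also have "\<dots> = exp (k * (282 * n powr (3/2)))" by (simp only: exp_of_nat_mult)
    also have "\<dots> = 2 powr (k * m)" by (simp add: powr_def m_def)
    finally show "real (card \<G>) \<le> 2 powr (k * m)" .
  qed simp
  also have "\<dots> = 2 powr (k * m + k * m * 2 ^ (t + 2))" by (simp only: powr_add)
  also have "k * m + k * m * 2 ^ (t + 2) = 282 / ln 2 * k * (1 + 2 ^ (t + 2)) * n powr (3/2)"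
    by (simp add: m_def algebra_simps add_divide_distrib)
  finally show ?thesis .
qed

lemma Forb_L_C4_subset:
  "Forb_L_C4 n r \<subseteq> Pair {1..n} ` {E. linear_C4_free {1..n} E r}"
proof
  fix H assume H: "H \<in> Forb_L_C4 n r"
  obtain W E where "H = (W, E)" by (cases H)
  then have "H = ({1..n}, E)" using H by (auto simp: Forb_L_C4_def)
  moreover from this have "linear_C4_free {1..n} E r"
    using H by unfold_locales
      (auto simp: Forb_L_C4_def uniform_hypergraph_def linear_hypergraph_def)
  ultimately show "H \<in> Pair {1..n} ` {E. linear_C4_free {1..n} E r}" by blast
qed

theorem theorem1p1:
  fixes r :: nat
  assumes "r \<ge> 3"
  shows "\<exists>C::real. C > 0 \<and>
    (\<forall>n::nat. n > 0 \<longrightarrow> real (card (Forb_L_C4 n r)) \<le> 2 powr (C * real n powr (3/2)))"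
proof (intro exI conjI allI impI)
  let ?C = "282 / ln 2 * Suc (2 * closing_bound r) * (1 + 2 ^ (codeg_bound r + 2)) :: real"
  have "0 < (1 + 2 ^ (codeg_bound r + 2) :: real)" by (intro add_pos_pos) auto
  then show "?C > 0" by (intro mult_pos_pos) auto
  fix n :: nat
  have fin: "finite {E. linear_C4_free {1..n} E r}"
    by (rule finite_subset[of _ "Pow (Pow {1..n})"])
      (auto dest!: linear_C4_free.edge)
  have "card (Forb_L_C4 n r) \<le> card (Pair {1..n} ` {E. linear_C4_free {1..n} E r})"
    using fin by (intro card_mono Forb_L_C4_subset) auto
  also have "\<dots> \<le> card {E. linear_C4_free {1..n} E r}" by (rule card_image_le[OF fin])
  finally have "real (card (Forb_L_C4 n r)) \<le> real (card {E. linear_C4_free {1..n} E r})" by simp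
  also have "\<dots> \<le> 2 powr (?C * n powr (3/2))"
    by (rule card_linear_C4_free) (use assms in auto)
  finally show "real (card (Forb_L_C4 n r)) \<le> 2 powr (?C * real n powr (3/2))" .
qed

end
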